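(* Let $(A_k)_{k\in\mathbb{Z}_{\ge 0}}$ be a sequence of tropical adjacency matrices in $\mathbb{T}^{N\times N}$. Then the switching-topology consensus protocol $$\mathbf{x}(k+1)=A_k\otimes\mathbf{x}(k),\qquad k\in\mathbb{Z}_{\ge 0},$$ converges for all initial conditions $\mathbf{x}(0)\in\mathbb{R}^N$ if and only if there exists $k\in\mathbb{N}$ such that $A_k\otimes A_{k-1}\otimes\cdots\otimes A_0=\mathbf{0}$.
   Context: $\mathbb{T}=\{0,-\infty\}$, with tropical operations $a\oplus b=\max(a,b)$, $a\otimes b=a+b$ on $\mathbb{R}\cup\{-\infty\}$. For matrices, $(A\otimes B)_{ij}=\max_l\{a_{il}+b_{lj}\}$, and for $\mathbf{x}\in\mathbb{R}^N$, $(A\otimes\mathbf{x})_i=\max_j\{a_{ij}+x_j\}$. A tropical adjacency matrix is a matrix in $\mathbb{T}^{N\times N}$ all of whose diagonal entries are $0$; it is the matrix of a directed graph on $\{1,\ldots,N\}$ with self loops, where the $(i,j)$ entry is $0$ if $i=j$ or $(j,i)$ is an edge, and $-\infty$ otherwise. $\mathbf{0}$ denotes the $N\times N$ matrix all of whose entries are the real number $0$. The protocol, started at $\mathbf{x}(0)=(x_1(0),\ldots,x_N(0))$, converges if there is $n\in\mathbb{N}$ such that for all $k\ge n$ and all $i\in\{1,\ldots,N\}$, $x_i(k)=\max_{j}\{x_j(0)\}$. *)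

theory Defs
  imports "HOL-Analysis.Finite_Cartesian_Product" "HOL-Library.Extended_Real"
begin

text \<open>
  The max-plus semiring (real numbers together with minus infinity) is represented inside
  \<^typ>\<open>ereal\<close>: tropical addition is \<^const>\<open>max\<close>, tropical multiplication is \<open>+\<close>.  The value
  \<open>\<infinity>\<close> never arises from the matrices and initial vectors considered here.
  The index set \<open>{1, \<dots>, N}\<close> is a finite type \<open>'n\<close>.
\<close>

definition trop_mat_mult :: "ereal^'l^'m \<Rightarrow> ereal^'n^'l \<Rightarrow> ereal^'n^'m"
    (infixl \<open>\<otimes>\<otimes>\<close> 70) where
  "A \<otimes>\<otimes> B = (\<chi> i j. MAX l. A $ i $ l + B $ l $ j)"

definition trop_mat_vec :: "ereal^'n^'m \<Rightarrow> ereal^'n \<Rightarrow> ereal^'m"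
    (infixr \<open>\<otimes>v\<close> 70) where
  "A \<otimes>v x = (\<chi> i. MAX j. A $ i $ j + x $ j)"

definition trop_adjacency :: "ereal^'n^'n \<Rightarrow> bool" where
  "trop_adjacency A \<longleftrightarrow> (\<forall>i j. A $ i $ j \<in> {0, -\<infinity>}) \<and> (\<forall>i. A $ i $ i = 0)"

text \<open>The backward product of \<open>A 0, \<dots>, A k\<close>, with \<open>A k\<close> as the leftmost factor.\<close>

primrec trop_backward_prod :: "(nat \<Rightarrow> ereal^'n^'n) \<Rightarrow> nat \<Rightarrow> ereal^'n^'n" where
  "trop_backward_prod A 0 = A 0"
| "trop_backward_prod A (Suc k) = A (Suc k) \<otimes>\<otimes> trop_backward_prod A k"

primrec consensus_protocol ::
    "(nat \<Rightarrow> ereal^'n^'n) \<Rightarrow> real^'n \<Rightarrow> nat \<Rightarrow> ereal^'n" where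
  "consensus_protocol A x0 0 = (\<chi> i. ereal (x0 $ i))"
| "consensus_protocol A x0 (Suc k) = A k \<otimes>v consensus_protocol A x0 k"

definition reaches_max_consensus :: "(nat \<Rightarrow> ereal^'n) \<Rightarrow> bool" where
  "reaches_max_consensus x \<longleftrightarrow> (\<exists>n. \<forall>k\<ge>n. \<forall>i. x k $ i = (MAX j. x 0 $ j))"

end

theory Submission imports Defs begin

text \<open>
  By associativity \<open>x (k + 1)\<close> is the backward product of \<open>A 0, \<dots>, A k\<close> applied to \<open>x 0\<close>.  If that
  product is the zero matrix, then it remains so after multiplying by further adjacency matrices,
  and applying it gives the maximum in every component.  Conversely, starting from the indicator
  vector of \<open>j\<close>, the \<open>i\<close>-th component can only become \<open>1\<close> if the \<open>(i, j)\<close> entry of the product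
  is \<open>0\<close>; running this for the finitely many \<open>j\<close> simultaneously gives the zero matrix.
\<close>

text \<open>Tropical distributivity: translation by \<open>a\<close>, even an infinite one, is
  monotone and so commutes with the maximum of a finite nonempty set.\<close>

lemma ereal_add_Max_image:
  fixes a :: ereal and f :: "'a::finite \<Rightarrow> ereal"
  shows "a + (MAX j. f j) = (MAX j. a + f j)"
  using mono_Max_commute[of "(+) a" "range f"]
  by (simp add: mono_def add_left_mono image_image)

lemma Max_range_swap:
  fixes f :: "'a::finite \<Rightarrow> 'b::finite \<Rightarrow> 'c::linorder"
  shows "(MAX i. MAX j. f i j) = (MAX j. MAX i. f i j)"
proof -
  \<comment> \<open>Stated for arbitrary \<open>g\<close> so that \<open>f\<close> and its transpose
    each give one of the two inequalities.\<close>
  have le: "g i j \<le> (MAX i. MAX j. g i j)" for g :: "'x::finite \<Rightarrow> 'y::finite \<Rightarrow> 'c" and i j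
  proof -
    have "g i j \<le> (MAX j. g i j)" by (rule Max_ge) auto
    also have "\<dots> \<le> (MAX i. MAX j. g i j)" by (rule Max_ge) auto
    finally show ?thesis .
  qed
  show ?thesis
    using le[of f] le[of "\<lambda>j i. f i j"] by (intro antisym) (simp_all add: image_subset_iff)
qed

lemma trop_mat_vec_assoc: "(A \<otimes>\<otimes> B) \<otimes>v x = A \<otimes>v (B \<otimes>v x)"
proof -
  have "(MAX j. (MAX l. A $ i $ l + B $ l $ j) + x $ j)
      = (MAX l. A $ i $ l + (MAX j. B $ l $ j + x $ j))" for i
    \<comment> \<open>Distributivity turns both sides into iterated maxima of the same triple sums,
      taken in opposite orders.\<close>
    unfolding ereal_add_Max_image add.commute[of "Max _"]
    by (subst Max_range_swap) (simp add: ac_simps)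
  then show ?thesis
    by (simp add: trop_mat_vec_def trop_mat_mult_def vec_eq_iff)
qed

lemma consensus_protocol_Suc:
  "consensus_protocol A x0 (Suc k) = trop_backward_prod A k \<otimes>v consensus_protocol A x0 0"
  by (induction k) (simp_all add: trop_mat_vec_assoc)

lemma trop_mat_mult_entries:
  assumes "\<And>i j. A $ i $ j \<in> {0, -\<infinity>}" "\<And>i j. B $ i $ j \<in> {0, -\<infinity>}"
  shows "(A \<otimes>\<otimes> B) $ i $ j \<in> {0, -\<infinity>}"
proof -
  have "(MAX l. A $ i $ l + B $ l $ j) \<in> range (\<lambda>l. A $ i $ l + B $ l $ j)"
    by (rule Max_in) auto
  then obtain l where "(A \<otimes>\<otimes> B) $ i $ j = A $ i $ l + B $ l $ j"
    unfolding trop_mat_mult_def vec_lambda_beta by blast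
  then show ?thesis
    using assms(1)[of i l] assms(2)[of l j] by auto
qed

lemma trop_backward_prod_entries:
  assumes "\<And>k. trop_adjacency (A k)"
  shows "trop_backward_prod A k $ i $ j \<in> {0, -\<infinity>}"
proof (induction k arbitrary: i j)
  case 0
  then show ?case using assms by (simp add: trop_adjacency_def)
next
  case (Suc k)
  then show ?case
    using assms unfolding trop_backward_prod.simps trop_adjacency_def
    by (intro trop_mat_mult_entries) blast+
qed

text \<open>Each entry of the product is a row maximum of \<open>A\<close>; no entry exceeds 0, and
  the self loop on the diagonal attains it.\<close>

lemma trop_adjacency_mult_zero:
  assumes "trop_adjacency A"
  shows "A \<otimes>\<otimes> (\<chi> i j. 0) = (\<chi> i j. 0)"
proof -
  have "(MAX l. A $ i $ l) = 0" for i
  proof (rule Max_eqI)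
    show "y \<le> 0" if y: "y \<in> range (\<lambda>l. A $ i $ l)" for y
    proof -
      obtain l where "y = A $ i $ l" using y by blast
      moreover have "A $ i $ l \<in> {0, -\<infinity>}" using assms unfolding trop_adjacency_def by blast
      ultimately show ?thesis by auto
    qed
    show "0 \<in> range (\<lambda>l. A $ i $ l)"
      using assms unfolding trop_adjacency_def by (metis rangeI)
  qed simp
  then show ?thesis by (simp add: trop_mat_mult_def vec_eq_iff)
qed

lemma trop_backward_prod_zero_mono:
  assumes "\<And>k. trop_adjacency (A k)"
    and "trop_backward_prod A k = (\<chi> i j. 0)" "k \<le> m"
  shows "trop_backward_prod A m = (\<chi> i j. 0)"
  using \<open>k \<le> m\<close>
  by (induction rule: dec_induct) (simp_all add: assms trop_adjacency_mult_zero)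

text \<open>Some term of the maximum equals 1. Terms with \<open>l\<close> other than
  \<open>j\<close> are at most 0, so it is the term at \<open>j\<close>, which rules out the entry
  \<open>-\<infinity>\<close>.\<close>

lemma trop_mat_vec_indicator_eq_1D:
  assumes "\<And>l. P $ i $ l \<in> {0, -\<infinity>}"
    and "(P \<otimes>v (\<chi> l. ereal (axis j 1 $ l))) $ i = 1"
  shows "P $ i $ j = 0"
proof -
  let ?f = "\<lambda>l. P $ i $ l + ereal (axis j 1 $ l)"
  have "(MAX l. ?f l) \<in> range ?f"
    by (rule Max_in) auto
  then obtain l where "?f l = 1"
    using assms(2) unfolding trop_mat_vec_def vec_lambda_beta by auto
  then show ?thesis
    using assms(1)[of l] by (cases "l = j") (auto simp: axis_def)
qed

theorem theorem5p1:
  fixes A :: "nat \<Rightarrow> ereal^'n^'n"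
  assumes "\<And>k. trop_adjacency (A k)"
  shows "(\<forall>x0 :: real^'n. reaches_max_consensus (consensus_protocol A x0)) \<longleftrightarrow>
         (\<exists>k. trop_backward_prod A k = (\<chi> i j. 0))"
proof
  assume L: "\<forall>x0 :: real^'n. reaches_max_consensus (consensus_protocol A x0)"
  let ?e = "\<lambda>j :: 'n. axis j (1 :: real)"
  have "\<exists>n. \<forall>k\<ge>n. \<forall>i. consensus_protocol A (?e j) k $ i = 1" for j
  proof -
    have "(MAX l. ereal (?e j $ l)) = 1"
      by (rule Max_eqI) (auto simp: axis_def intro!: image_eqI[of _ _ j])
    then show ?thesis
      using L[rule_format, of "?e j"] by (simp add: reaches_max_consensus_def)
  qed
  then obtain n where n: "\<And>j k i. n j \<le> k \<Longrightarrow> consensus_protocol A (?e j) k $ i = 1"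
    by metis
  \<comment> \<open>A common time for all indicator vectors, available because the index type is
    finite.\<close>
  define m where "m = (MAX j. n j)"
  have "trop_backward_prod A m $ i $ j = 0" for i j
  proof (rule trop_mat_vec_indicator_eq_1D)
    show "trop_backward_prod A m $ i $ l \<in> {0, -\<infinity>}" for l
      by (rule trop_backward_prod_entries[OF assms])
    have "n j \<le> Suc m"
      unfolding m_def by (intro le_SucI Max_ge) auto
    from n[OF this] show "(trop_backward_prod A m \<otimes>v (\<chi> l. ereal (?e j $ l))) $ i = 1"
      unfolding consensus_protocol_Suc by simp
  qed
  then show "\<exists>k. trop_backward_prod A k = (\<chi> i j. 0)"
    by (auto simp: vec_eq_iff)
next
  assume "\<exists>k. trop_backward_prod A k = (\<chi> i j. 0)"
  then obtain k where k: "trop_backward_prod A k = (\<chi> i j. 0)" ..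
  show "\<forall>x0 :: real^'n. reaches_max_consensus (consensus_protocol A x0)"
    unfolding reaches_max_consensus_def
  proof (intro allI exI impI)
    fix x0 :: "real^'n" and m i
    \<comment> \<open>This fixes the witness for the consensus time: the product of
      \<open>A 0\<close> up to \<open>A k\<close> yields the state at time
      \<open>Suc k\<close>.\<close>
    assume "Suc k \<le> m"
    then obtain l where l: "m = Suc l" "k \<le> l"
      by (metis Suc_le_D Suc_le_mono)
    show "consensus_protocol A x0 m $ i = (MAX j. consensus_protocol A x0 0 $ j)"
      unfolding l(1) consensus_protocol_Suc trop_backward_prod_zero_mono[OF assms k l(2)]
      by (simp add: trop_mat_vec_def)
  qed
qed

end
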